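(* Let $\alpha,\beta,\gamma$ satisfy $0<\alpha,\beta\le\gamma\le 1$, and let $X_j^n$ be the forest-fire random field with parameters $\alpha,\beta,\gamma$, with $Y_n=\sum_{j=0}^n X_j^n$ for $n\ge 0$. If $\alpha+\beta<1$ and $\gamma<1$, then $\sum_{n=0}^\infty Y_n<\infty$ almost surely.
   Context: Forest-fire random field with parameters $\alpha,\beta,\gamma$, where $0\le\alpha,\beta\le\gamma\le1$: $\mathbb{N}=\{0,1,2,\ldots\}$. A family of $\{0,1\}$-valued random variables $X(j,k)$, $j,k\in\mathbb{N}$, is given on a probability space; write $X_j^n=X(j,n-j)$ for $0\le j\le n$. Boundary conditions: $X(0,0)=1$ and $X(j,-1)=X(-1,k)=0$ for all $j,k\in\mathbb{N}$, i.e. $X_0^0=1$ and $X_{-1}^n=X_{n+1}^n=0$ for all $n\ge0$. Let $\mathcal{F}_n=\sigma(X_j^m:\ 0\le j\le m\le n)$. The law of the field is defined inductively: for every $n\ge0$, given $\mathcal{F}_n$, the variables $X_0^{n+1},\ldots,X_{n+1}^{n+1}$ are conditionally independent, and for each $0\le j\le n+1$ the conditional law of $X_j^{n+1}$ given $\mathcal{F}_n$ depends only on $(X_{j-1}^n,X_j^n)$: the conditional probability that $X_j^{n+1}=1$ equals $0$ if $(X_{j-1}^n,X_j^n)=(0,0)$, equals $\alpha$ if it is $(1,0)$, equals $\beta$ if it is $(0,1)$, and equals $\gamma$ if it is $(1,1)$. *)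

theory Defs
  imports "HOL-Probability.Probability"
begin

definition real_cond_prob :: "'w measure \<Rightarrow> 'w measure \<Rightarrow> 'w set \<Rightarrow> 'w \<Rightarrow> real" where
  "real_cond_prob M F A = real_cond_exp M F (indicator A)"

text \<open>Conditional independence of a family of random variables given a sub-sigma-algebra:
  the product rule holds almost surely for every finite subfamily and every choice of
  measurable sets.\<close>

definition cond_indep_vars ::
  "'w measure \<Rightarrow> 'w measure \<Rightarrow> ('i \<Rightarrow> 'b measure) \<Rightarrow> ('i \<Rightarrow> 'w \<Rightarrow> 'b) \<Rightarrow> 'i set \<Rightarrow> bool" where
  "cond_indep_vars M F N Z I \<longleftrightarrow>
     subalgebra M F \<and>
     (\<forall>i\<in>I. Z i \<in> measurable M (N i)) \<and>
     (\<forall>J\<subseteq>I. finite J \<longrightarrow> J \<noteq> {} \<longrightarrow>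
        (\<forall>A. (\<forall>j\<in>J. A j \<in> sets (N j)) \<longrightarrow>
          (AE \<omega> in M. real_cond_prob M F (\<Inter>j\<in>J. Z j -` A j \<inter> space M) \<omega> =
             (\<Prod>j\<in>J. real_cond_prob M F (Z j -` A j \<inter> space M) \<omega>))))"

text \<open>\<open>diag X n j\<close> is \<open>X(j, n - j)\<close>, the \<open>j\<close>-th site on the \<open>n\<close>-th antidiagonal.
  The integer index \<open>j\<close> makes room for the boundary sites \<open>j = -1\<close> and \<open>j = n + 1\<close>,
  where the value is 0.\<close>

definition diag :: "(nat \<Rightarrow> nat \<Rightarrow> 'w \<Rightarrow> nat) \<Rightarrow> nat \<Rightarrow> int \<Rightarrow> 'w \<Rightarrow> nat" where
  "diag X n j \<omega> = (if 0 \<le> j \<and> j \<le> int n then X (nat j) (n - nat j) \<omega> else 0)"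

definition diag_filtration :: "'w measure \<Rightarrow> (nat \<Rightarrow> nat \<Rightarrow> 'w \<Rightarrow> nat) \<Rightarrow> nat \<Rightarrow> 'w measure" where
  "diag_filtration M X n =
     sigma (space M) {diag X m j -` A \<inter> space M | m j A. 0 \<le> j \<and> j \<le> int m \<and> m \<le> n}"

definition diag_sum :: "(nat \<Rightarrow> nat \<Rightarrow> 'w \<Rightarrow> nat) \<Rightarrow> nat \<Rightarrow> 'w \<Rightarrow> nat" where
  "diag_sum X n \<omega> = (\<Sum>j = 0..int n. diag X n j \<omega>)"

text \<open>Only the values at arguments in \<open>{0, 1}\<close> matter.\<close>

definition fire_prob :: "real \<Rightarrow> real \<Rightarrow> real \<Rightarrow> nat \<Rightarrow> nat \<Rightarrow> real" where
  "fire_prob \<alpha> \<beta> \<gamma> a b =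
     (if a = 0 \<and> b = 0 then 0
      else if a = 1 \<and> b = 0 then \<alpha>
      else if a = 0 \<and> b = 1 then \<beta>
      else \<gamma>)"

locale forest_fire_field = prob_space M
  for M :: "'w measure"
    and X :: "nat \<Rightarrow> nat \<Rightarrow> 'w \<Rightarrow> nat"
    and \<alpha> \<beta> \<gamma> :: real +
  assumes params: "0 \<le> \<alpha>" "0 \<le> \<beta>" "\<alpha> \<le> \<gamma>" "\<beta> \<le> \<gamma>" "\<gamma> \<le> 1"
    and measurable_X: "\<And>j k. X j k \<in> measurable M (count_space UNIV)"
    and range_X: "\<And>j k \<omega>. \<omega> \<in> space M \<Longrightarrow> X j k \<omega> \<in> {0, 1}"
    and X_origin: "\<And>\<omega>. \<omega> \<in> space M \<Longrightarrow> X 0 0 \<omega> = 1"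
    and cond_indep: "\<And>n. cond_indep_vars M (diag_filtration M X n) (\<lambda>_. count_space UNIV)
                       (diag X (n + 1)) {0..int (n + 1)}"
    and cond_law: "\<And>n j. 0 \<le> j \<Longrightarrow> j \<le> int (n + 1) \<Longrightarrow>
       AE \<omega> in M. real_cond_prob M (diag_filtration M X n)
                     {\<omega> \<in> space M. diag X (n + 1) j \<omega> = 1} \<omega> =
                   fire_prob \<alpha> \<beta> \<gamma> (diag X n (j - 1) \<omega>) (diag X n j \<omega>)"

end

theory Submission
  imports Defs
begin

text \<open>With \<open>\<rho> = max (\<alpha> + \<beta>) \<gamma> < 1\<close>, each update probability is at most
  \<open>\<alpha> a + (\<rho> - \<alpha>) b\<close>, where \<open>(a, b)\<close> are the values of the two predecessors. Summing over an
  antidiagonal, every site is counted once as a left and once as a right predecessor, so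
  \<open>E Y\<^sub>n\<^sub>+\<^sub>1 \<le> \<rho> E Y\<^sub>n\<close>. Hence the expectation of the sum of all \<open>Y\<^sub>n\<close> is at most the geometric
  series \<open>1 / (1 - \<rho>)\<close>.\<close>

lemma fire_prob_le_linear:
  assumes "0 \<le> \<alpha>" "\<alpha> + \<beta> \<le> \<rho>" "\<gamma> \<le> \<rho>" "a \<in> {0, 1}" "b \<in> {0, 1}"
  shows "fire_prob \<alpha> \<beta> \<gamma> a b \<le> \<alpha> * real a + (\<rho> - \<alpha>) * real b"
  \<comment> \<open>Cases (0,0) and (1,0) are equalities; (0,1) is \<beta> \<le> \<rho> - \<alpha>,
    and (1,1) is \<gamma> \<le> \<rho>.\<close>
  using assms by (auto simp: fire_prob_def)

context forest_fire_field
begin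

lemma diag_in_01: "\<omega> \<in> space M \<Longrightarrow> diag X n j \<omega> \<in> {0, 1}"
  using range_X[of \<omega> "nat j" "n - nat j"] by (auto simp: diag_def)

lemma measurable_diag [measurable]: "diag X n j \<in> measurable M (count_space UNIV)"
proof (cases "0 \<le> j \<and> j \<le> int n")
  case True
  then have "diag X n j = X (nat j) (n - nat j)" by (auto simp: diag_def)
  then show ?thesis using measurable_X by simp
next
  case False
  then have "diag X n j = (\<lambda>_. 0)" by (auto simp: diag_def)
  then show ?thesis by simp
qed

lemma integrable_diag: "integrable M (\<lambda>\<omega>. real (diag X n j \<omega>))"
proof (rule integrable_const_bound)
  have "real (diag X n j \<omega>) \<le> 1" if "\<omega> \<in> space M" for \<omega>
    using diag_in_01[OF that, of n j] by auto
  then show "AE \<omega> in M. norm (real (diag X n j \<omega>)) \<le> 1" by auto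
qed measurable

text \<open>Integrating a linear bound on the conditional probability leaves only the marginal means
  of the two predecessors; their joint law never enters.\<close>

lemma expectation_diag_Suc_le:
  assumes \<rho>: "\<alpha> + \<beta> \<le> \<rho>" "\<gamma> \<le> \<rho>" and j: "0 \<le> j" "j \<le> int (n + 1)"
  shows "expectation (\<lambda>\<omega>. real (diag X (n + 1) j \<omega>)) \<le>
    \<alpha> * expectation (\<lambda>\<omega>. real (diag X n (j - 1) \<omega>)) +
    (\<rho> - \<alpha>) * expectation (\<lambda>\<omega>. real (diag X n j \<omega>))"
proof -
  let ?F = "diag_filtration M X n"
  let ?A = "{\<omega> \<in> space M. diag X (n + 1) j \<omega> = 1}"
  have "subalgebra M ?F" using cond_indep[of n] by (simp add: cond_indep_vars_def)
  \<comment> \<open>Finiteness of \<open>M\<close> makes the subalgebra sigma-finite, the setting in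
    which \<open>real_cond_exp\<close> preserves integrals.\<close>
  then interpret F: finite_measure_subalgebra M ?F by unfold_locales
  have "?A \<in> sets M" by measurable
  then have int: "integrable M (indicator ?A :: _ \<Rightarrow> real)"
    by (simp add: emeasure_eq_measure)
  \<comment> \<open>A {0,1}-valued variable coincides on \<open>space M\<close> with the indicator
    of the event that it equals 1.\<close>
  have "expectation (\<lambda>\<omega>. real (diag X (n + 1) j \<omega>)) = expectation (indicator ?A)"
    by (rule Bochner_Integration.integral_cong)
      (use diag_in_01[of _ "n + 1" j] in \<open>auto simp: indicator_def\<close>)
  also have "\<dots> = expectation (real_cond_prob M ?F ?A)"
    unfolding real_cond_prob_def using F.real_cond_exp_int(2)[OF int] by simp
  also have "\<dots> \<le> expectation (\<lambda>\<omega>. \<alpha> * real (diag X n (j - 1) \<omega>) + (\<rho> - \<alpha>) * real (diag X n j \<omega>))"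
  proof (rule integral_mono_AE)
    show "integrable M (real_cond_prob M ?F ?A)"
      unfolding real_cond_prob_def by (rule F.real_cond_exp_int(1)[OF int])
    show "integrable M (\<lambda>\<omega>. \<alpha> * real (diag X n (j - 1) \<omega>) + (\<rho> - \<alpha>) * real (diag X n j \<omega>))"
      using integrable_diag by simp
    show "AE \<omega> in M. real_cond_prob M ?F ?A \<omega> \<le>
        \<alpha> * real (diag X n (j - 1) \<omega>) + (\<rho> - \<alpha>) * real (diag X n j \<omega>)"
      using cond_law[OF j] AE_space
    proof eventually_elim
      case (elim \<omega>)
      then show ?case
        using fire_prob_le_linear[OF params(1) \<rho> diag_in_01[of \<omega> n "j - 1"] diag_in_01[of \<omega> n j]]
        by simp
    qed
  qed
  also have "\<dots> = \<alpha> * expectation (\<lambda>\<omega>. real (diag X n (j - 1) \<omega>)) +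
      (\<rho> - \<alpha>) * expectation (\<lambda>\<omega>. real (diag X n j \<omega>))"
    using integrable_diag by simp
  finally show ?thesis .
qed

lemma expectation_diag_sum:
  "expectation (\<lambda>\<omega>. real (diag_sum X n \<omega>)) = (\<Sum>j = 0..int n. expectation (\<lambda>\<omega>. real (diag X n j \<omega>)))"
  unfolding diag_sum_def of_nat_sum using integrable_diag by (rule Bochner_Integration.integral_sum)

lemma integrable_diag_sum: "integrable M (\<lambda>\<omega>. real (diag_sum X n \<omega>))"
  unfolding diag_sum_def of_nat_sum using integrable_diag by (rule Bochner_Integration.integrable_sum)

lemma expectation_diag_sum_Suc_le:
  assumes \<rho>: "\<alpha> + \<beta> \<le> \<rho>" "\<gamma> \<le> \<rho>"
  shows "expectation (\<lambda>\<omega>. real (diag_sum X (n + 1) \<omega>)) \<le> \<rho> * expectation (\<lambda>\<omega>. real (diag_sum X n \<omega>))"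
proof -
  define e where "e j = expectation (\<lambda>\<omega>. real (diag X n j \<omega>))" for j
  \<comment> \<open>The default value 0 of \<open>diag\<close> outside its range encodes the
    boundary condition, so both neighbours just beyond the diagonal have mean 0.\<close>
  have e_out: "e (- 1) = 0" "e (int n + 1) = 0" by (simp_all add: e_def diag_def)
  have sum_e: "(\<Sum>j = 0..int n. e j) = expectation (\<lambda>\<omega>. real (diag_sum X n \<omega>))"
    by (simp add: expectation_diag_sum e_def)
  \<comment> \<open>Left predecessors range over -1..n, right predecessors over 0..n+1. Dropping the
    one boundary term from each leaves the same sum over 0..n.\<close>
  have "(\<Sum>j = 0..int (n + 1). e (j - 1)) = (\<Sum>j = - 1..int n. e j)"
    by (rule sum.reindex_bij_witness[of _ "\<lambda>j. j + 1" "\<lambda>j. j - 1"]) auto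
  also have "\<dots> = (\<Sum>j = 0..int n. e j)"
  proof (rule sum.mono_neutral_right)
    show "\<forall>j\<in>{- 1..int n} - {0..int n}. e j = 0"
    proof
      fix j assume "j \<in> {- 1..int n} - {0..int n}"
      then have "j = - 1" by auto
      then show "e j = 0" using e_out by simp
    qed
  qed auto
  finally have left: "(\<Sum>j = 0..int (n + 1). e (j - 1)) = (\<Sum>j = 0..int n. e j)" .
  have right: "(\<Sum>j = 0..int (n + 1). e j) = (\<Sum>j = 0..int n. e j)"
  proof (rule sum.mono_neutral_right)
    show "\<forall>j\<in>{0..int (n + 1)} - {0..int n}. e j = 0"
    proof
      fix j assume "j \<in> {0..int (n + 1)} - {0..int n}"
      then have "j = int n + 1" by auto
      then show "e j = 0" using e_out by simp
    qed
  qed auto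
  have "expectation (\<lambda>\<omega>. real (diag_sum X (n + 1) \<omega>)) \<le>
      (\<Sum>j = 0..int (n + 1). \<alpha> * e (j - 1) + (\<rho> - \<alpha>) * e j)"
    unfolding expectation_diag_sum e_def
    by (rule sum_mono) (use expectation_diag_Suc_le[OF \<rho>] in auto)
  \<comment> \<open>The weights \<alpha> and \<rho> - \<alpha> now multiply the same sum and add up
    to \<rho>.\<close>
  also have "\<dots> = \<rho> * (\<Sum>j = 0..int n. e j)"
    unfolding sum.distrib sum_distrib_left[symmetric] left right by (simp add: algebra_simps)
  finally show ?thesis unfolding sum_e .
qed

lemma expectation_diag_sum_le_power:
  assumes "\<alpha> + \<beta> \<le> \<rho>" "\<gamma> \<le> \<rho>"
  shows "expectation (\<lambda>\<omega>. real (diag_sum X n \<omega>)) \<le> \<rho> ^ n"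
proof (induction n)
  case 0
  \<comment> \<open>Diagonal 0 consists of the origin alone, where the field is 1.\<close>
  have "expectation (\<lambda>\<omega>. real (diag_sum X 0 \<omega>)) = expectation (\<lambda>_. 1)"
    by (rule Bochner_Integration.integral_cong) (auto simp: diag_sum_def diag_def X_origin)
  then show ?case by (simp add: prob_space)
next
  case (Suc n)
  have "0 \<le> \<rho>" using params assms by linarith
  then have "\<rho> * expectation (\<lambda>\<omega>. real (diag_sum X n \<omega>)) \<le> \<rho> * \<rho> ^ n"
    by (rule mult_left_mono[OF Suc])
  then show ?case using expectation_diag_sum_Suc_le[OF assms, of n] by simp
qed

lemma AE_suminf_diag_sum_finite:
  assumes "\<alpha> + \<beta> < 1" "\<gamma> < 1"
  shows "AE \<omega> in M. (\<Sum>n. ennreal (real (diag_sum X n \<omega>))) < \<infinity>"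
proof -
  \<comment> \<open>This is the least \<rho> that the one-step bound allows; the two strict
    hypotheses say exactly that it is below 1.\<close>
  define \<rho> where "\<rho> = max (\<alpha> + \<beta>) \<gamma>"
  have \<rho>: "\<alpha> + \<beta> \<le> \<rho>" "\<gamma> \<le> \<rho>" "0 \<le> \<rho>" "\<rho> < 1"
    using assms params by (auto simp: \<rho>_def)
  have meas [measurable]: "(\<lambda>\<omega>. real (diag_sum X n \<omega>)) \<in> borel_measurable M" for n
    using integrable_diag_sum by (rule borel_measurable_integrable)
  \<comment> \<open>Working in \<open>ennreal\<close> lets sum and integral be exchanged by monotone
    convergence, with no prior summability.\<close>
  have "(\<integral>\<^sup>+\<omega>. (\<Sum>n. ennreal (real (diag_sum X n \<omega>))) \<partial>M) =
      (\<Sum>n. \<integral>\<^sup>+\<omega>. ennreal (real (diag_sum X n \<omega>)) \<partial>M)"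
    by (rule nn_integral_suminf) measurable
  also have "\<dots> \<le> (\<Sum>n. ennreal (\<rho> ^ n))"
  proof (rule suminf_le)
    show "(\<integral>\<^sup>+\<omega>. ennreal (real (diag_sum X n \<omega>)) \<partial>M) \<le> ennreal (\<rho> ^ n)" for n
      using expectation_diag_sum_le_power[OF \<rho>(1,2), of n]
      by (subst nn_integral_eq_integral[OF integrable_diag_sum]) (auto intro: ennreal_leI)
  qed auto
  also have "\<dots> = ennreal (\<Sum>n. \<rho> ^ n)"
    using \<rho> by (intro suminf_ennreal2 summable_geometric) auto
  finally have "(\<integral>\<^sup>+\<omega>. (\<Sum>n. ennreal (real (diag_sum X n \<omega>))) \<partial>M) \<noteq> \<infinity>"
    by (auto simp: top_unique)
  \<comment> \<open>A nonnegative function with finite integral is finite almost everywhere.\<close>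
  then have "AE \<omega> in M. (\<Sum>n. ennreal (real (diag_sum X n \<omega>))) \<noteq> \<infinity>"
    by (intro nn_integral_PInf_AE) measurable
  then show ?thesis by (simp add: less_top)
qed

end

theorem mainTheorem1:
  fixes M :: "'w measure"
    and X :: "nat \<Rightarrow> nat \<Rightarrow> 'w \<Rightarrow> nat"
    and \<alpha> \<beta> \<gamma> :: real
  assumes "0 < \<alpha>" "0 < \<beta>" "\<alpha> \<le> \<gamma>" "\<beta> \<le> \<gamma>" "\<gamma> \<le> 1"
    and "forest_fire_field M X \<alpha> \<beta> \<gamma>"
    and "\<alpha> + \<beta> < 1" "\<gamma> < 1"
  shows "AE \<omega> in M. (\<Sum>n. ennreal (real (diag_sum X n \<omega>))) < \<infinity>"
  using assms by (intro forest_fire_field.AE_suminf_diag_sum_finite)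

end
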